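(* Let $\mathfrak{U}$ be a Banach algebra such that $\mathfrak{U}^\sharp$ is symmetrically pseudo-amenable, with a symmetric approximate diagonal $\{\mathbf{t}_\lambda\}_{\lambda\in\Lambda}\subseteq\mathfrak{U}^\sharp\widehat{\otimes}\mathfrak{U}^\sharp$. Let $X$ be a Banach $\mathfrak{U}$-bimodule such that for each $x\in X$ the net $\{\psi_x(\mathbf{t}_\lambda)\}_{\lambda\in\Lambda}$ is bounded, and let $D:\mathfrak{U}\to X$ be a bounded Lie derivation such that the net $\{\Phi_D(\mathbf{t}_\lambda)\}_{\lambda\in\Lambda}$ is bounded. Then there exist a bounded derivation $d:\mathfrak{U}\to X$ and a bounded linear map $\tau:\mathfrak{U}\to\mathcal{Z}_{\mathfrak{U}}(X)$ with $\tau(ab-ba)=0$ for all $a,b\in\mathfrak{U}$ (a central trace), such that $D=d+\tau$.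
   Context: $\mathfrak{U}^\sharp=\mathfrak{U}\oplus\mathbb{C}1$ is the unitization of $\mathfrak{U}$ with the $\ell^1$-norm (a unit is adjoined even if $\mathfrak{U}$ is unital); a Banach $\mathfrak{U}$-bimodule $X$ is made a unital Banach $\mathfrak{U}^\sharp$-bimodule by $1x=x1=x$. $\mathcal{Z}_{\mathfrak{U}}(X)=\{x\in X: ax=xa\ \forall a\in\mathfrak{U}\}$. For $x\in X$, $\psi_x:\mathfrak{U}^\sharp\widehat{\otimes}\mathfrak{U}^\sharp\to X$ is the bounded linear map with $\psi_x(a\otimes b)=axb$. For a bounded linear map $T:\mathfrak{U}\to X$, extended to $\mathfrak{U}^\sharp$ by $T(1)=0$, $\Phi_T:\mathfrak{U}^\sharp\widehat{\otimes}\mathfrak{U}^\sharp\to X$ is the bounded linear map with $\Phi_T(a\otimes b)=aT(b)$. A linear map $\delta$ is a derivation if $\delta(ab)=\delta(a)b+a\delta(b)$, and a Lie derivation if $\delta(ab-ba)=\delta(a)b+a\delta(b)-\delta(b)a-b\delta(a)$, for all $a,b$. For a Banach algebra $\mathfrak{A}$, $\mathfrak{A}\widehat{\otimes}\mathfrak{A}$ is the projective tensor product with $a(b\otimes c)=ab\otimes c$, $(b\otimes c)a=b\otimes ca$, $\pi(b\otimes c)=bc$ (extended linearly and continuously); the flip is $(b\otimes c)^\circ=c\otimes b$ and $\mathbf{t}$ is symmetric if $\mathbf{t}^\circ=\mathbf{t}$. A symmetric approximate diagonal is a net $\{\mathbf{t}_\lambda\}$ (not necessarily bounded) of symmetric elements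 with $a\mathbf{t}_\lambda-\mathbf{t}_\lambda a\to0$ and $\pi(\mathbf{t}_\lambda)a\to a$ for all $a\in\mathfrak{A}$; $\mathfrak{A}$ is symmetrically pseudo-amenable if it has one. *)

theory Defs
  imports Complex_Main
begin

text \<open>Isabelle/HOL only provides real normed spaces as type classes, so we add the
complex scalar multiplication as an extra operation compatible with the real structure.\<close>

class cnormed_vector = real_normed_vector +
  fixes scaleC :: "complex \<Rightarrow> 'a \<Rightarrow> 'a"
  assumes scaleC_add_right: "scaleC c (x + y) = scaleC c x + scaleC c y"
    and scaleC_add_left: "scaleC (c + c') x = scaleC c x + scaleC c' x"
    and scaleC_scaleC: "scaleC c (scaleC c' x) = scaleC (c * c') x"
    and scaleC_one: "scaleC 1 x = x"
    and scaleC_of_real: "scaleC (of_real r) x = scaleR r x"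
    and norm_scaleC: "norm (scaleC c x) = cmod c * norm x"

class cbanach = cnormed_vector + banach

class cbanach_algebra = cbanach + real_normed_algebra +
  assumes scaleC_mult_left: "scaleC c x * y = scaleC c (x * y)"
    and scaleC_mult_right: "x * scaleC c y = scaleC c (x * y)"

instantiation complex :: cbanach
begin
definition scaleC_complex :: "complex \<Rightarrow> complex \<Rightarrow> complex" where
  "scaleC_complex c x = c * x"
instance
  by standard (auto simp: scaleC_complex_def algebra_simps norm_mult scaleR_conv_of_real)
end

definition clinear :: "('a::cnormed_vector \<Rightarrow> 'b::cnormed_vector) \<Rightarrow> bool" where
  "clinear f \<longleftrightarrow> (\<forall>x y. f (x + y) = f x + f y) \<and> (\<forall>c x. f (scaleC c x) = scaleC c (f x))"

definition bounded_map :: "('a::real_normed_vector \<Rightarrow> 'b::real_normed_vector) \<Rightarrow> bool" where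
  "bounded_map f \<longleftrightarrow> (\<exists>K. \<forall>x. norm (f x) \<le> norm x * K)"

definition banach_bimodule ::
  "('a::cbanach_algebra \<Rightarrow> 'x::cbanach \<Rightarrow> 'x) \<Rightarrow> ('x \<Rightarrow> 'a \<Rightarrow> 'x) \<Rightarrow> bool" where
  "banach_bimodule la ra \<longleftrightarrow>
     (\<forall>a b x. la (a + b) x = la a x + la b x) \<and>
     (\<forall>a x y. la a (x + y) = la a x + la a y) \<and>
     (\<forall>c a x. la (scaleC c a) x = scaleC c (la a x)) \<and>
     (\<forall>c a x. la a (scaleC c x) = scaleC c (la a x)) \<and>
     (\<forall>a x y. ra (x + y) a = ra x a + ra y a) \<and>
     (\<forall>a b x. ra x (a + b) = ra x a + ra x b) \<and>
     (\<forall>c a x. ra x (scaleC c a) = scaleC c (ra x a)) \<and>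
     (\<forall>c a x. ra (scaleC c x) a = scaleC c (ra x a)) \<and>
     (\<forall>a b x. la a (la b x) = la (a * b) x) \<and>
     (\<forall>a b x. ra (ra x a) b = ra x (a * b)) \<and>
     (\<forall>a b x. ra (la a x) b = la a (ra x b)) \<and>
     (\<forall>a x. norm (la a x) \<le> norm a * norm x) \<and>
     (\<forall>a x. norm (ra x a) \<le> norm x * norm a)"

definition is_derivation :: "('a::cbanach_algebra \<Rightarrow> 'x \<Rightarrow> 'x) \<Rightarrow> ('x \<Rightarrow> 'a \<Rightarrow> 'x::cbanach)
    \<Rightarrow> ('a \<Rightarrow> 'x) \<Rightarrow> bool" where
  "is_derivation la ra d \<longleftrightarrow> (\<forall>a b. d (a * b) = ra (d a) b + la a (d b))"

definition is_lie_derivation :: "('a::cbanach_algebra \<Rightarrow> 'x \<Rightarrow> 'x) \<Rightarrow> ('x \<Rightarrow> 'a \<Rightarrow> 'x::cbanach)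
    \<Rightarrow> ('a \<Rightarrow> 'x) \<Rightarrow> bool" where
  "is_lie_derivation la ra d \<longleftrightarrow>
     (\<forall>a b. d (a * b - b * a) = ra (d a) b + la a (d b) - ra (d b) a - la b (d a))"

definition centre :: "('a::cbanach_algebra \<Rightarrow> 'x \<Rightarrow> 'x) \<Rightarrow> ('x \<Rightarrow> 'a \<Rightarrow> 'x) \<Rightarrow> 'x set" where
  "centre la ra = {x. \<forall>a. la a x = ra x a}"

type_synonym 'a unitz = "'a \<times> complex"

definition unorm :: "'a::cbanach_algebra unitz \<Rightarrow> real" where
  "unorm u = norm (fst u) + cmod (snd u)"

definition uadd :: "'a::cbanach_algebra unitz \<Rightarrow> 'a unitz \<Rightarrow> 'a unitz" where
  "uadd u v = (fst u + fst v, snd u + snd v)"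

definition usub :: "'a::cbanach_algebra unitz \<Rightarrow> 'a unitz \<Rightarrow> 'a unitz" where
  "usub u v = (fst u - fst v, snd u - snd v)"

definition uscale :: "complex \<Rightarrow> 'a::cbanach_algebra unitz \<Rightarrow> 'a unitz" where
  "uscale c u = (scaleC c (fst u), c * snd u)"

definition umult :: "'a::cbanach_algebra unitz \<Rightarrow> 'a unitz \<Rightarrow> 'a unitz" where
  "umult u v = (fst u * fst v + scaleC (snd u) (fst v) + scaleC (snd v) (fst u), snd u * snd v)"

definition ula :: "('a::cbanach_algebra \<Rightarrow> 'x \<Rightarrow> 'x) \<Rightarrow> 'a unitz \<Rightarrow> 'x::cbanach \<Rightarrow> 'x" where
  "ula la u x = la (fst u) x + scaleC (snd u) x"

definition ura :: "('x \<Rightarrow> 'a \<Rightarrow> 'x) \<Rightarrow> 'x::cbanach \<Rightarrow> 'a::cbanach_algebra unitz \<Rightarrow> 'x" where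
  "ura ra x u = ra x (fst u) + scaleC (snd u) x"

text \<open>An element of the projective tensor product is given by a representation
\<open>\<Sum>\<^sub>n u\<^sub>n \<otimes> v\<^sub>n\<close> with \<open>\<Sum>\<^sub>n \<parallel>u\<^sub>n\<parallel>\<parallel>v\<^sub>n\<parallel> < \<infinity>\<close>.  Elements are identified through the
isometric canonical embedding into the bidual, i.e. into the dual of the space of bounded
bilinear forms \<open>(\<AA>\<^sup>\<sharp> \<widehat>\<otimes> \<AA>\<^sup>\<sharp>)\<^sup>* = B(\<AA>\<^sup>\<sharp> \<times> \<AA>\<^sup>\<sharp>, \<complex>)\<close>.\<close>

type_synonym 'a trep = "nat \<Rightarrow> 'a unitz \<times> 'a unitz"

definition valid_trep :: "'a::cbanach_algebra trep \<Rightarrow> bool" where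
  "valid_trep r \<longleftrightarrow> summable (\<lambda>n. unorm (fst (r n)) * unorm (snd (r n)))"

definition ubilinear :: "('a::cbanach_algebra unitz \<Rightarrow> 'a unitz \<Rightarrow> complex) \<Rightarrow> bool" where
  "ubilinear \<phi> \<longleftrightarrow>
     (\<forall>u u' v. \<phi> (uadd u u') v = \<phi> u v + \<phi> u' v) \<and>
     (\<forall>u v v'. \<phi> u (uadd v v') = \<phi> u v + \<phi> u v') \<and>
     (\<forall>c u v. \<phi> (uscale c u) v = c * \<phi> u v) \<and>
     (\<forall>c u v. \<phi> u (uscale c v) = c * \<phi> u v)"

definition bbforms :: "('a::cbanach_algebra unitz \<Rightarrow> 'a unitz \<Rightarrow> complex) set" where
  "bbforms = {\<phi>. ubilinear \<phi> \<and> (\<exists>K. \<forall>u v. cmod (\<phi> u v) \<le> K * unorm u * unorm v)}"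

definition bbforms1 :: "('a::cbanach_algebra unitz \<Rightarrow> 'a unitz \<Rightarrow> complex) set" where
  "bbforms1 = {\<phi>. ubilinear \<phi> \<and> (\<forall>u v. cmod (\<phi> u v) \<le> unorm u * unorm v)}"

definition tval :: "'a::cbanach_algebra trep \<Rightarrow> ('a unitz \<Rightarrow> 'a unitz \<Rightarrow> complex) \<Rightarrow> complex" where
  "tval r \<phi> = (\<Sum>n. \<phi> (fst (r n)) (snd (r n)))"

text \<open>Projective norm of \<open>t - s\<close>.\<close>
definition tdist :: "'a::cbanach_algebra trep \<Rightarrow> 'a trep \<Rightarrow> real" where
  "tdist r s = (SUP \<phi>\<in>bbforms1. cmod (tval r \<phi> - tval s \<phi>))"

definition tflip :: "'a::cbanach_algebra trep \<Rightarrow> 'a trep" where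
  "tflip r = (\<lambda>n. (snd (r n), fst (r n)))"

definition tsymmetric :: "'a::cbanach_algebra trep \<Rightarrow> bool" where
  "tsymmetric r \<longleftrightarrow> (\<forall>\<phi>\<in>bbforms. tval (tflip r) \<phi> = tval r \<phi>)"

definition tlmult :: "'a::cbanach_algebra unitz \<Rightarrow> 'a trep \<Rightarrow> 'a trep" where
  "tlmult a r = (\<lambda>n. (umult a (fst (r n)), snd (r n)))"

definition trmult :: "'a::cbanach_algebra trep \<Rightarrow> 'a unitz \<Rightarrow> 'a trep" where
  "trmult r a = (\<lambda>n. (fst (r n), umult (snd (r n)) a))"

definition tpi :: "'a::cbanach_algebra trep \<Rightarrow> 'a unitz" where
  "tpi r = ((\<Sum>n. fst (umult (fst (r n)) (snd (r n)))), (\<Sum>n. snd (umult (fst (r n)) (snd (r n)))))"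

definition psi :: "('a::cbanach_algebra \<Rightarrow> 'x \<Rightarrow> 'x) \<Rightarrow> ('x \<Rightarrow> 'a \<Rightarrow> 'x) \<Rightarrow> 'x::cbanach
    \<Rightarrow> 'a trep \<Rightarrow> 'x" where
  "psi la ra x r = (\<Sum>n. ura ra (ula la (fst (r n)) x) (snd (r n)))"

text \<open>\<open>\<Phi>\<^sub>T(a \<otimes> b) = a T(b)\<close>, with \<open>T\<close> extended to \<open>\<AA>\<^sup>\<sharp>\<close> by \<open>T(1) = 0\<close>.\<close>
definition Phi :: "('a::cbanach_algebra \<Rightarrow> 'x \<Rightarrow> 'x) \<Rightarrow> ('a \<Rightarrow> 'x::cbanach) \<Rightarrow> 'a trep \<Rightarrow> 'x" where
  "Phi la T r = (\<Sum>n. ula la (fst (r n)) (T (fst (snd (r n)))))"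

definition directed_set :: "'l set \<Rightarrow> ('l \<Rightarrow> 'l \<Rightarrow> bool) \<Rightarrow> bool" where
  "directed_set \<Lambda> le \<longleftrightarrow> \<Lambda> \<noteq> {} \<and> (\<forall>i\<in>\<Lambda>. le i i) \<and>
     (\<forall>i\<in>\<Lambda>. \<forall>j\<in>\<Lambda>. \<forall>k\<in>\<Lambda>. le i j \<longrightarrow> le j k \<longrightarrow> le i k) \<and>
     (\<forall>i\<in>\<Lambda>. \<forall>j\<in>\<Lambda>. \<exists>k\<in>\<Lambda>. le i k \<and> le j k)"

definition net_to_zero :: "'l set \<Rightarrow> ('l \<Rightarrow> 'l \<Rightarrow> bool) \<Rightarrow> ('l \<Rightarrow> real) \<Rightarrow> bool" where
  "net_to_zero \<Lambda> le f \<longleftrightarrow> (\<forall>e>0. \<exists>i\<in>\<Lambda>. \<forall>j\<in>\<Lambda>. le i j \<longrightarrow> \<bar>f j\<bar> < e)"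

definition symm_approx_diag :: "'l set \<Rightarrow> ('l \<Rightarrow> 'l \<Rightarrow> bool) \<Rightarrow> ('l \<Rightarrow> 'a::cbanach_algebra trep) \<Rightarrow> bool" where
  "symm_approx_diag \<Lambda> le t \<longleftrightarrow> directed_set \<Lambda> le \<and>
     (\<forall>i\<in>\<Lambda>. valid_trep (t i) \<and> tsymmetric (t i)) \<and>
     (\<forall>a. net_to_zero \<Lambda> le (\<lambda>i. tdist (tlmult a (t i)) (trmult (t i) a))) \<and>
     (\<forall>a. net_to_zero \<Lambda> le (\<lambda>i. unorm (usub (umult (tpi (t i)) a) a)))"

end

theory Submission
  imports Defs "HOL-Analysis.Analysis"
begin

text \<open>Put \<open>x\<^sub>\<lambda> = \<Phi>\<^sub>D(t\<^sub>\<lambda>)\<close> and \<open>y\<^sub>\<lambda> = \<psi>\<^bsub>D(a)\<^esub>(t\<^sub>\<lambda>)\<close>.  The Lie identity and the symmetry of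
\<open>t\<^sub>\<lambda>\<close> give \<open>D(a) = [a, x\<^sub>\<lambda>] + y\<^sub>\<lambda> + o(1)\<close>, where \<open>y\<^sub>\<lambda>\<close> is asymptotically central.
Apply \<open>z \<mapsto> \<psi>\<^sub>z(t\<^sub>\<mu>)\<close> to this identity: it kills \<open>[a, x\<^sub>\<lambda>]\<close> as \<open>\<mu>\<close> grows,
uniformly in \<open>\<lambda>\<close> because \<open>x\<^sub>\<lambda>\<close> is bounded, and for fixed \<open>\<mu>\<close> it acts on the asymptotically
central \<open>y\<^sub>\<lambda>\<close> as \<open>\<pi>(t\<^sub>\<mu>)\<close>, which is close to \<open>1\<close>.  Hence \<open>y\<^sub>\<lambda>\<close> is Cauchy in norm (so there is
no need to pass to the bidual of \<open>X\<close>).  Its limit is \<open>\<tau>(a)\<close>, and \<open>d(a) = lim [a, x\<^sub>\<lambda>]\<close> is a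
derivation as a limit of inner ones.  The Hahn--Banach theorem carries the convergence
\<open>a t\<^sub>\<lambda> - t\<^sub>\<lambda> a \<rightarrow> 0\<close>, which is measured by scalar bilinear forms, over to \<open>X\<close>-valued ones.\<close>

section \<open>Norming functionals\<close>

text \<open>Positive homogeneity appears as an inequality, which is all that has to be checked for
  the infima below; using it for both \<open>c\<close> and \<open>inverse c\<close> gives
  equality.\<close>

definition sublinear :: "('v::real_vector \<Rightarrow> real) \<Rightarrow> bool" where
  "sublinear p \<longleftrightarrow> (\<forall>x y. p (x + y) \<le> p x + p y) \<and> (\<forall>c x. c > 0 \<longrightarrow> p (c *\<^sub>R x) \<le> c * p x)"

lemma sublinear_add: "sublinear p \<Longrightarrow> p (x + y) \<le> p x + p y"
  by (simp add: sublinear_def)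

lemma sublinear_scale:
  assumes "sublinear p" "c > 0"
  shows "p (c *\<^sub>R x) = c * p x"
proof (rule antisym)
  have "p (inverse c *\<^sub>R c *\<^sub>R x) \<le> inverse c * p (c *\<^sub>R x)"
    using assms by (simp only: sublinear_def positive_imp_inverse_positive)
  then show "c * p x \<le> p (c *\<^sub>R x)"
    using assms(2) by (simp add: field_simps)
qed (use assms in \<open>simp add: sublinear_def\<close>)

lemma sublinear_0: "sublinear p \<Longrightarrow> p 0 = 0"
  using sublinear_scale[of p 2 0] by simp

lemma sublinear_minus: "sublinear p \<Longrightarrow> - p (- x) \<le> p x"
  using sublinear_add[of p x "- x"] sublinear_0[of p] by simp

text \<open>The witness is \<open>q x = inf {p (x + t y) - t p y | t >= 0}\<close>:
  \<open>t = 0\<close> gives \<open>q <= p\<close>, and \<open>t = 1\<close> at \<open>- y\<close>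
  gives the last inequality. It serves twice: it forces a minimal sublinear functional to be odd,
  and it prescribes the value of a dominated functional at one vector.\<close>

lemma sublinear_shift:
  assumes "sublinear p"
  obtains q where "sublinear q" "\<And>x. q x \<le> p x" "q (- y) \<le> - p y"
proof -
  define h where "h x t = p (x + t *\<^sub>R y) - t * p y" for x t
  define q where "q x = (INF t\<in>{0..}. h x t)" for x
  have scale: "p (t *\<^sub>R y) = t * p y" if "t \<ge> 0" for t
    using that sublinear_scale[OF assms, of t y] sublinear_0[OF assms] by (cases "t = 0") auto
  \<comment> \<open>A lower bound independent of \<open>t\<close> makes the infimum finite.\<close>
  have lower: "- p (- x) \<le> h x t" if "t \<ge> 0" for x t
    using sublinear_add[OF assms, of "x + t *\<^sub>R y" "- x"] scale[OF that] by (simp add: h_def)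
  have q_le: "q x \<le> h x t" if "t \<ge> 0" for x t
    unfolding q_def by (rule cINF_lower) (use that lower in \<open>auto intro!: bdd_belowI2[where m = "- p (- x)"]\<close>)
  have q_ge: "m \<le> q x" if "\<And>t. t \<ge> 0 \<Longrightarrow> m \<le> h x t" for m x
    unfolding q_def by (rule cINF_greatest) (use that in auto)
  have "sublinear q"
    unfolding sublinear_def
  proof (intro conjI allI impI)
    fix x x'
    have *: "q (x + x') \<le> h x t + h x' t'" if "t \<ge> 0" "t' \<ge> 0" for t t'
    proof -
      have "q (x + x') \<le> h (x + x') (t + t')"
        by (rule q_le) (use that in auto)
      also have "\<dots> \<le> h x t + h x' t'"
        using sublinear_add[OF assms, of "x + t *\<^sub>R y" "x' + t' *\<^sub>R y"]
        by (simp add: h_def algebra_simps)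
      finally show ?thesis .
    qed
    have "q (x + x') - h x t \<le> q x'" if "t \<ge> 0" for t
      by (rule q_ge) (use *[OF that] in \<open>simp add: algebra_simps\<close>)
    then have "q (x + x') - q x' \<le> q x"
      by (intro q_ge) (simp add: algebra_simps)
    then show "q (x + x') \<le> q x + q x'"
      by simp
  next
    fix c :: real and x assume c: "c > 0"
    have "q (c *\<^sub>R x) / c \<le> h x t" if "t \<ge> 0" for t
    proof -
      have "q (c *\<^sub>R x) \<le> h (c *\<^sub>R x) (c * t)"
        by (rule q_le) (use that c in auto)
      also have "\<dots> = c * h x t"
        using sublinear_scale[OF assms c, of "x + t *\<^sub>R y"] by (simp add: h_def algebra_simps)
      finally show ?thesis
        using c by (simp add: field_simps)
    qed
    then have "q (c *\<^sub>R x) / c \<le> q x"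
      by (rule q_ge)
    then show "q (c *\<^sub>R x) \<le> c * q x"
      using c by (simp add: field_simps)
  qed
  moreover have "q x \<le> p x" for x
    using q_le[of 0 x] by (simp add: h_def)
  moreover have "q (- y) \<le> - p y"
    using q_le[of 1 "- y"] sublinear_0[OF assms] by (simp add: h_def)
  ultimately show ?thesis
    by (rule that)
qed

text \<open>Zorn's lemma below \<open>p\<close>: the pointwise infimum of a nonempty chain is again
  sublinear.\<close>

lemma minimal_sublinear:
  fixes p :: "'v::real_vector \<Rightarrow> real"
  assumes p: "sublinear p"
  obtains m where "sublinear m" "\<And>x. m x \<le> p x"
    "\<And>q. sublinear q \<Longrightarrow> (\<And>x. q x \<le> m x) \<Longrightarrow> q = m"
proof -
  define A where "A = {q. sublinear q \<and> q \<le> p}"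
  have "\<exists>m\<in>A. \<forall>a\<in>A. a \<le> m \<longrightarrow> a = m"
  proof (rule predicate_Zorn)
    \<comment> \<open>The order is reversed, so that the maximal element given by Zorn's lemma is a
      minimal functional.\<close>
    show "partial_order_on A (relation_of (\<lambda>x y. y \<le> x) A)"
      by (rule partial_order_on_relation_ofI) auto
  next
    fix C assume "C \<in> Chains (relation_of (\<lambda>x y. y \<le> x) A)"
    then have CA: "C \<subseteq> A" and chain: "\<And>a b. a \<in> C \<Longrightarrow> b \<in> C \<Longrightarrow> a \<le> b \<or> b \<le> a"
      by (auto simp: Chains_def relation_of_def)
    show "\<exists>u\<in>A. \<forall>a\<in>C. u \<le> a"
    proof (cases "C = {}")
      case True
      then show ?thesis using p by (auto simp: A_def)
    next
      case False
      define u where "u x = (INF q\<in>C. q x)" for x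
      have sub: "sublinear q" and le: "q x \<le> p x" if "q \<in> C" for q x
        using that CA by (auto simp: A_def le_fun_def)
      have lower: "- p (- x) \<le> q x" if "q \<in> C" for q x
        using sublinear_minus[OF sub[OF that], of x] le[OF that, of "- x"] by simp
      have u_le: "u x \<le> q x" if "q \<in> C" for q x
        unfolding u_def by (rule cINF_lower) (use that lower in \<open>auto intro!: bdd_belowI2[where m = "- p (- x)"]\<close>)
      have u_ge: "m \<le> u x" if "\<And>q. q \<in> C \<Longrightarrow> m \<le> q x" for m x
        unfolding u_def by (rule cINF_greatest) (use that False in auto)
      have "sublinear u"
        unfolding sublinear_def
      proof (intro conjI allI impI)
        fix x y
        \<comment> \<open>Members of a chain are comparable, and the smaller of \<open>q\<close> and
          \<open>q'\<close> can be used at both points.\<close>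
        have *: "u (x + y) \<le> q x + q' y" if q: "q \<in> C" "q' \<in> C" for q q'
          using chain[OF q]
        proof
          assume "q \<le> q'"
          then show ?thesis
            using u_le[OF q(1), of "x + y"] sublinear_add[OF sub[OF q(1)], of x y] le_funD[of q q' y]
            by linarith
        next
          assume "q' \<le> q"
          then show ?thesis
            using u_le[OF q(2), of "x + y"] sublinear_add[OF sub[OF q(2)], of x y] le_funD[of q' q x]
            by linarith
        qed
        have "u (x + y) - q x \<le> u y" if "q \<in> C" for q
          by (rule u_ge) (use *[OF that] in \<open>simp add: algebra_simps\<close>)
        then have "u (x + y) - u y \<le> u x"
          by (intro u_ge) (simp add: algebra_simps)
        then show "u (x + y) \<le> u x + u y"
          by simp
      next
        fix c :: real and x assume c: "c > 0"
        have "u (c *\<^sub>R x) / c \<le> u x"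
        proof (rule u_ge)
          fix q assume q: "q \<in> C"
          show "u (c *\<^sub>R x) / c \<le> q x"
            using u_le[OF q, of "c *\<^sub>R x"] sublinear_scale[OF sub[OF q] c, of x] c
            by (simp add: field_simps)
        qed
        then show "u (c *\<^sub>R x) \<le> c * u x"
          using c by (simp add: field_simps)
      qed
      moreover have "u \<le> p"
      proof (rule le_funI)
        fix x
        from False obtain q where "q \<in> C" by blast
        then show "u x \<le> p x" using u_le[of q x] le[of q x] by linarith
      qed
      ultimately show ?thesis
        using u_le by (auto simp: A_def le_fun_def)
    qed
  qed
  then obtain m where m: "m \<in> A" and min: "\<And>a. a \<in> A \<Longrightarrow> a \<le> m \<Longrightarrow> a = m"
    by blast
  show ?thesis
  proof (rule that)
    show "sublinear m" "m x \<le> p x" for x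
      using m by (auto simp: A_def le_fun_def)
    show "q = m" if "sublinear q" "\<And>x. q x \<le> m x" for q
    proof (rule min)
      show "q \<le> m" using that by (simp add: le_fun_def)
      with m that show "q \<in> A" by (auto simp: A_def intro: order_trans)
    qed
  qed
qed

text \<open>A minimal functional \<open>m\<close> equals its own shift along every \<open>y\<close>,
  so it is odd. Subadditivity at \<open>x, y\<close> and at \<open>- x, - y\<close> then gives
  additivity.\<close>

lemma Hahn_Banach_sublinear:
  fixes p :: "'v::real_vector \<Rightarrow> real"
  assumes p: "sublinear p"
  obtains f where "linear f" "\<And>x. f x \<le> p x"
proof -
  obtain m where m: "sublinear m" and le: "\<And>x. m x \<le> p x"
    and min: "\<And>q. sublinear q \<Longrightarrow> (\<And>x. q x \<le> m x) \<Longrightarrow> q = m"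
    using minimal_sublinear[OF p] by blast
  have neg: "m (- y) = - m y" for y
  proof -
    obtain q where "sublinear q" "\<And>x. q x \<le> m x" "q (- y) \<le> - m y"
      using sublinear_shift[OF m, of y] by blast
    then have "m (- y) \<le> - m y"
      using min by blast
    with sublinear_minus[OF m, of y] show ?thesis by simp
  qed
  have "linear m"
  proof (rule linearI)
    fix x y
    show "m (x + y) = m x + m y"
      using sublinear_add[OF m, of x y] sublinear_add[OF m, of "- x" "- y"] neg[of x] neg[of y] neg[of "x + y"]
      by simp
  next
    fix c :: real and x
    consider "c > 0" | "c = 0" | "c < 0"
      using less_linear[of c 0] by blast
    then show "m (c *\<^sub>R x) = c *\<^sub>R m x"
    proof cases
      case 3
      then show ?thesis
        using sublinear_scale[OF m, of "- c" x] neg[of "c *\<^sub>R x"] by simp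
    qed (use sublinear_scale[OF m] sublinear_0[OF m] in auto)
  qed
  then show ?thesis using le by (rule that)
qed

text \<open>A functional dominated by the shift of the norm along \<open>x\<close> satisfies
  \<open>f (- x) <= - norm x\<close>, hence attains the norm at \<open>x\<close>.\<close>

lemma norming_functional_real:
  fixes x :: "'v::real_normed_vector"
  obtains f where "linear f" "\<And>y. f y \<le> norm y" "f x = norm x"
proof -
  have "sublinear (norm :: 'v \<Rightarrow> real)"
    by (auto simp: sublinear_def norm_triangle_ineq)
  then obtain q where q: "sublinear q" "\<And>y. q y \<le> norm y" "q (- x) \<le> - norm x"
    using sublinear_shift[of norm x] by blast
  obtain f where f: "linear f" "\<And>y. f y \<le> q y"
    using Hahn_Banach_sublinear[OF q(1)] by blast
  have le: "f y \<le> norm y" for y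
    using f(2) q(2) order_trans by blast
  have "f x = norm x"
    using f(2)[of "- x"] q(3) le[of x] linear_neg[OF f(1), of x] by simp
  with f(1) le show ?thesis by (rule that)
qed

lemma clinear_imp_linear: "clinear f \<Longrightarrow> linear f"
  by (auto simp: clinear_def scaleC_of_real[symmetric] intro: linearI)

text \<open>Complexification of the real case by \<open>f y = g y - i g (i y)\<close>.\<close>

lemma norming_functional:
  fixes x :: "'v::cnormed_vector"
  obtains f :: "'v \<Rightarrow> complex" where "clinear f" "\<And>y. cmod (f y) \<le> norm y" "f x = norm x"
proof -
  obtain g where g: "linear g" "\<And>y. g y \<le> norm y" "g x = norm x"
    using norming_functional_real by blast
  define f where "f y = Complex (g y) (- g (scaleC \<i> y))" for y
  have scale: "f (scaleC c y) = c * f y" for c y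
  proof -
    have split: "g (scaleC c y) = Re c * g y + Im c * g (scaleC \<i> y)" for c y
    proof -
      have "scaleC c y = scaleC (of_real (Re c) + of_real (Im c) * \<i>) y"
        by (metis complex_eq mult.commute)
      then have "scaleC c y = Re c *\<^sub>R y + Im c *\<^sub>R scaleC \<i> y"
        by (simp add: scaleC_add_left scaleC_scaleC[symmetric] scaleC_of_real)
      then show ?thesis
        using g(1) by (simp add: linear_add linear_scale)
    qed
    have "g (scaleC \<i> (scaleC c y)) = - Im c * g y + Re c * g (scaleC \<i> y)"
      using split[of "\<i> * c" y] by (simp add: scaleC_scaleC)
    then show ?thesis
      using split[of c y] by (simp add: f_def complex_eq_iff algebra_simps)
  qed
  have lin: "clinear f"
    unfolding clinear_def scale scaleC_complex_def
    using g(1) by (simp add: f_def scaleC_add_right linear_add complex_eq_iff)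
  have bound: "cmod (f y) \<le> norm y" for y
  proof -
    \<comment> \<open>Rotating \<open>y\<close> by a unimodular scalar makes \<open>f\<close> real
      there, where it agrees with \<open>g\<close>.\<close>
    obtain c where c: "cmod c = 1" "c * f y = of_real (cmod (f y))"
    proof (cases "f y = 0")
      case False
      have "cnj (sgn (f y)) * f y = of_real (cmod (f y))"
        using False by (simp add: sgn_eq complex_norm_square[symmetric] field_simps power2_eq_square)
      then show ?thesis
        using False by (intro that[of "cnj (sgn (f y))"]) (simp_all add: norm_sgn)
    qed (use that[of 1] in auto)
    have "cmod (f y) = Re (f (scaleC c y))"
      using c by (simp add: scale)
    also have "\<dots> \<le> norm (scaleC c y)"
      using g(2) by (simp add: f_def)
    finally show ?thesis
      using c by (simp add: norm_scaleC)
  qed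
  have "f x = norm x"
  proof -
    \<comment> \<open>The real part already exhausts the bound on the modulus, so the imaginary part
      vanishes.\<close>
    have "Re (f x) = norm x" by (simp add: f_def g)
    moreover have "(cmod (f x))\<^sup>2 \<le> (norm x)\<^sup>2"
      by (rule power_mono[OF bound]) simp
    ultimately have "Im (f x) = 0"
      by (simp add: cmod_power2)
    with \<open>Re (f x) = norm x\<close> show ?thesis by (simp add: complex_eq_iff)
  qed
  with lin bound show ?thesis by (rule that)
qed

section \<open>Bounded bilinear maps on the unitization\<close>

lemma scaleC_0_right [simp]: "scaleC c (0::'v::cnormed_vector) = 0"
  using scaleC_add_right[of c 0 "0::'v"] by simp

lemma scaleC_0_left [simp]: "scaleC 0 (x::'v::cnormed_vector) = 0"
  using scaleC_add_left[of 0 0 x] by simp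

lemma bounded_linear_scaleC: "bounded_linear (scaleC c :: 'v::cnormed_vector \<Rightarrow> 'v)"
proof (rule bounded_linear_intro)
  show "scaleC c (r *\<^sub>R x) = r *\<^sub>R scaleC c x" for r and x :: 'v
    by (simp add: scaleC_of_real[symmetric] scaleC_scaleC mult.commute)
  show "norm (scaleC c x) \<le> norm x * cmod c" for x :: 'v
    by (simp add: norm_scaleC mult.commute)
qed (rule scaleC_add_right)

lemma scaleC_diff_right: "scaleC c (x - y) = scaleC c x - scaleC c (y::'v::cnormed_vector)"
  by (rule linear_diff[OF bounded_linear.linear[OF bounded_linear_scaleC]])

lemma clinear_add: "clinear f \<Longrightarrow> f (x + y) = f x + f y"
  and clinear_scale: "clinear f \<Longrightarrow> f (scaleC c x) = scaleC c (f x)"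
  by (simp_all add: clinear_def)

lemma fst_uadd: "fst (uadd u v) = fst u + fst v"
  and fst_uscale: "fst (uscale c u) = scaleC c (fst u)"
  by (simp_all add: uadd_def uscale_def)

lemma unorm_nonneg [simp]: "0 \<le> unorm u"
  by (simp add: unorm_def)

lemma unorm_umult_le: "unorm (umult u v) \<le> unorm u * unorm v"
proof -
  have "norm (fst u * fst v + scaleC (snd u) (fst v) + scaleC (snd v) (fst u))
      \<le> norm (fst u) * norm (fst v) + cmod (snd u) * norm (fst v) + cmod (snd v) * norm (fst u)"
    by (intro norm_triangle_mono norm_mult_ineq) (simp_all add: norm_scaleC)
  then show ?thesis
    by (simp add: unorm_def umult_def norm_mult algebra_simps)
qed

lemma umult_uadd_left: "umult (uadd u u') v = uadd (umult u v) (umult u' v)"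
  and umult_uadd_right: "umult v (uadd u u') = uadd (umult v u) (umult v u')"
  and umult_uscale_left: "umult (uscale c u) v = uscale c (umult u v)"
  and umult_uscale_right: "umult v (uscale c u) = uscale c (umult v u)"
  by (simp_all add: umult_def uadd_def uscale_def distrib_left distrib_right scaleC_add_left
      scaleC_add_right scaleC_scaleC scaleC_mult_left scaleC_mult_right mult.commute mult.left_commute)

text \<open>The values lie in an arbitrary Banach space, so that the scalar forms and the forms
  behind \<open>psi\<close> and \<open>Phi\<close> are treated together. The constant
  \<open>K\<close> is explicit because it reappears as a factor in every estimate against
  \<open>tdist\<close>.\<close>

definition bdd_bilinear ::
  "real \<Rightarrow> ('a::cbanach_algebra unitz \<Rightarrow> 'a unitz \<Rightarrow> 'y::cbanach) \<Rightarrow> bool" where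
  "bdd_bilinear K B \<longleftrightarrow>
     (\<forall>u u' v. B (uadd u u') v = B u v + B u' v) \<and>
     (\<forall>u v v'. B u (uadd v v') = B u v + B u v') \<and>
     (\<forall>c u v. B (uscale c u) v = scaleC c (B u v)) \<and>
     (\<forall>c u v. B u (uscale c v) = scaleC c (B u v)) \<and>
     (\<forall>u v. norm (B u v) \<le> K * unorm u * unorm v)"

text \<open>For bounded \<open>B\<close> and valid \<open>r\<close> this is the value, at the tensor
  represented by \<open>r\<close>, of the linear map on the projective tensor product induced by
  \<open>B\<close>.\<close>

definition tsum :: "('a::cbanach_algebra unitz \<Rightarrow> 'a unitz \<Rightarrow> 'y::cbanach) \<Rightarrow> 'a trep \<Rightarrow> 'y" where
  "tsum B r = (\<Sum>n. B (fst (r n)) (snd (r n)))"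

lemma bbforms_eq: "bbforms = {\<phi>. \<exists>K. bdd_bilinear K \<phi>}"
  and bbforms1_eq: "bbforms1 = {\<phi>. bdd_bilinear 1 \<phi>}"
  by (auto simp: bbforms_def bbforms1_def ubilinear_def bdd_bilinear_def scaleC_complex_def)

lemma tval_eq: "tval r \<phi> = tsum \<phi> r"
  by (simp add: tval_def tsum_def)

lemma bdd_bilinearI:
  assumes "\<And>u u' v. B (uadd u u') v = B u v + B u' v"
    and "\<And>u v v'. B u (uadd v v') = B u v + B u v'"
    and "\<And>c u v. B (uscale c u) v = scaleC c (B u v)"
    and "\<And>c u v. B u (uscale c v) = scaleC c (B u v)"
    and "\<And>u v. norm (B u v) \<le> K * unorm u * unorm v"
  shows "bdd_bilinear K B"
  unfolding bdd_bilinear_def by (intro conjI allI assms)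

lemma
  assumes "bdd_bilinear K B"
  shows bdd_bilinear_add_left: "B (uadd u u') v = B u v + B u' v"
    and bdd_bilinear_add_right: "B u (uadd v v') = B u v + B u v'"
    and bdd_bilinear_scale_left: "B (uscale c u) v = scaleC c (B u v)"
    and bdd_bilinear_scale_right: "B u (uscale c v) = scaleC c (B u v)"
    and bdd_bilinear_norm: "norm (B u v) \<le> K * unorm u * unorm v"
  using assms unfolding bdd_bilinear_def by blast+

lemmas bdd_bilinear_simps = bdd_bilinear_add_left bdd_bilinear_add_right
  bdd_bilinear_scale_left bdd_bilinear_scale_right

lemma bdd_bilinear_nonneg: "bdd_bilinear K B \<Longrightarrow> 0 \<le> K"
  using bdd_bilinear_norm[of K B "(0, 1)" "(0, 1)"]
  by (auto simp: unorm_def intro: order_trans[OF norm_ge_zero])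

lemma bdd_bilinear_swap:
  assumes "bdd_bilinear K B"
  shows "bdd_bilinear K (\<lambda>u v. B v u)"
proof (rule bdd_bilinearI)
  show "norm (B v u) \<le> K * unorm u * unorm v" for u v
    using bdd_bilinear_norm[OF assms, of v u] by (simp add: mult_ac)
qed (simp_all add: bdd_bilinear_simps[OF assms])

lemma bdd_bilinear_diff:
  assumes B: "bdd_bilinear K B" and C: "bdd_bilinear L C"
  shows "bdd_bilinear (K + L) (\<lambda>u v. B u v - C u v)"
proof (rule bdd_bilinearI)
  show "norm (B u v - C u v) \<le> (K + L) * unorm u * unorm v" for u v
    unfolding distrib_right
    by (intro norm_triangle_le_diff add_mono bdd_bilinear_norm B C)
qed (simp_all add: bdd_bilinear_simps[OF B] bdd_bilinear_simps[OF C] scaleC_diff_right)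

lemma bdd_bilinear_compose:
  assumes B: "bdd_bilinear K B" and f: "clinear f" and bd: "\<And>y. norm (f y) \<le> norm y * L"
    and L: "0 \<le> L"
  shows "bdd_bilinear (L * K) (\<lambda>u v. f (B u v))"
proof (rule bdd_bilinearI)
  show "norm (f (B u v)) \<le> L * K * unorm u * unorm v" for u v
    using bd[of "B u v"] mult_right_mono[OF bdd_bilinear_norm[OF B, of u v] L]
    by (simp add: mult_ac)
qed (simp_all add: bdd_bilinear_simps[OF B] clinear_add[OF f] clinear_scale[OF f])

lemma bdd_bilinear_umult:
  assumes B: "bdd_bilinear K B"
  shows "bdd_bilinear (K * unorm a) (\<lambda>u v. B (umult a u) v)"
    and "bdd_bilinear (K * unorm a) (\<lambda>u v. B (umult u a) v)"
    and "bdd_bilinear (K * unorm a) (\<lambda>u v. B u (umult a v))"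
    and "bdd_bilinear (K * unorm a) (\<lambda>u v. B u (umult v a))"
proof -
  have left: "bdd_bilinear (K * unorm a) (\<lambda>u v. B (umult a u) v)"
    "bdd_bilinear (K * unorm a) (\<lambda>u v. B (umult u a) v)" if "bdd_bilinear K B"
    for B :: "'a unitz \<Rightarrow> 'a unitz \<Rightarrow> 'b"
  proof -
    have "norm (B w v) \<le> K * unorm a * unorm u * unorm v" if "unorm w \<le> unorm a * unorm u" for u v w
    proof -
      have "norm (B w v) \<le> K * unorm w * unorm v"
        by (rule bdd_bilinear_norm) fact
      also have "\<dots> \<le> K * (unorm a * unorm u) * unorm v"
        using that bdd_bilinear_nonneg[OF \<open>bdd_bilinear K B\<close>] by (intro mult_right_mono mult_left_mono) auto
      finally show ?thesis by (simp add: mult_ac)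
    qed
    note bound = this
    have "unorm (umult a u) \<le> unorm a * unorm u" "unorm (umult u a) \<le> unorm a * unorm u" for u
      using unorm_umult_le[of a u] unorm_umult_le[of u a] by (simp_all add: mult.commute)
    note bound = bound[OF this(1)] bound[OF this(2)]
    show "bdd_bilinear (K * unorm a) (\<lambda>u v. B (umult a u) v)"
      by (rule bdd_bilinearI[OF _ _ _ _ bound(1)])
        (simp_all add: bdd_bilinear_simps[OF that] umult_uadd_right umult_uscale_right)
    show "bdd_bilinear (K * unorm a) (\<lambda>u v. B (umult u a) v)"
      by (rule bdd_bilinearI[OF _ _ _ _ bound(2)])
        (simp_all add: bdd_bilinear_simps[OF that] umult_uadd_left umult_uscale_left)
  qed
  show "bdd_bilinear (K * unorm a) (\<lambda>u v. B (umult a u) v)"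
    "bdd_bilinear (K * unorm a) (\<lambda>u v. B (umult u a) v)"
    by (fact left[OF B])+
  show "bdd_bilinear (K * unorm a) (\<lambda>u v. B u (umult a v))"
    "bdd_bilinear (K * unorm a) (\<lambda>u v. B u (umult v a))"
    by (fact left[OF bdd_bilinear_swap[OF B], THEN bdd_bilinear_swap])+
qed

section \<open>Evaluation of bounded bilinear maps on tensors\<close>

text \<open>An upper bound for the projective norm that depends on the representation. In the main
  argument it occurs only for a fixed index of the net.\<close>

definition rep_norm :: "'a::cbanach_algebra trep \<Rightarrow> real" where
  "rep_norm r = (\<Sum>n. unorm (fst (r n)) * unorm (snd (r n)))"

lemma summable_norm_bdd_bilinear:
  assumes "bdd_bilinear K B" "valid_trep r"
  shows "summable (\<lambda>n. norm (B (fst (r n)) (snd (r n))))"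
proof (rule summable_comparison_test'[where N = 0])
  show "summable (\<lambda>n. K * (unorm (fst (r n)) * unorm (snd (r n))))"
    using assms(2) by (simp add: valid_trep_def summable_mult)
qed (use bdd_bilinear_norm[OF assms(1)] in \<open>simp add: mult.assoc\<close>)

lemmas summable_bdd_bilinear = summable_norm_cancel[OF summable_norm_bdd_bilinear]

lemma norm_tsum_le:
  assumes B: "bdd_bilinear K B" and r: "valid_trep r"
  shows "norm (tsum B r) \<le> K * rep_norm r"
proof -
  have "norm (tsum B r) \<le> (\<Sum>n. norm (B (fst (r n)) (snd (r n))))"
    unfolding tsum_def by (rule summable_norm[OF summable_norm_bdd_bilinear[OF B r]])
  also have "\<dots> \<le> (\<Sum>n. K * (unorm (fst (r n)) * unorm (snd (r n))))"
    using r bdd_bilinear_norm[OF B]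
    by (intro suminf_le summable_norm_bdd_bilinear[OF B r] summable_mult)
      (auto simp: valid_trep_def mult.assoc)
  also have "\<dots> = K * rep_norm r"
    unfolding rep_norm_def using r by (intro suminf_mult) (simp add: valid_trep_def)
  finally show ?thesis .
qed

lemma tsum_diff:
  assumes "bdd_bilinear K B" "bdd_bilinear L C" "valid_trep r"
  shows "tsum (\<lambda>u v. B u v - C u v) r = tsum B r - tsum C r"
  unfolding tsum_def by (rule suminf_diff[symmetric]) (use assms summable_bdd_bilinear in blast)+

lemma tsum_bounded_linear:
  assumes "bdd_bilinear K B" "bounded_linear f" "valid_trep r"
  shows "tsum (\<lambda>u v. f (B u v)) r = f (tsum B r)"
  unfolding tsum_def
  by (rule bounded_linear.suminf[symmetric]) (use assms summable_bdd_bilinear in blast)+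

lemma bounded_linear_functional:
  fixes f :: "'v::cnormed_vector \<Rightarrow> complex"
  assumes "clinear f" "\<And>y. cmod (f y) \<le> norm y"
  shows "bounded_linear f"
  using assms clinear_imp_linear[OF assms(1)]
  by (intro bounded_linear_intro[where K = 1]) (auto simp: linear_add linear_scale)

lemma valid_trep_umult:
  assumes "valid_trep r"
  shows "valid_trep (tlmult a r)" "valid_trep (trmult r a)"
proof -
  have s: "summable (\<lambda>n. unorm a * (unorm (fst (r n)) * unorm (snd (r n))))"
    using assms by (simp add: valid_trep_def summable_mult)
  have "unorm (umult a u) * unorm v \<le> unorm a * (unorm u * unorm v)" for u v
    using mult_right_mono[OF unorm_umult_le[of a u] unorm_nonneg[of v]] by (simp add: mult_ac)
  then show "valid_trep (tlmult a r)"
    unfolding valid_trep_def tlmult_def by (intro summable_comparison_test'[OF s, of 0]) simp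
  have "unorm u * unorm (umult v a) \<le> unorm a * (unorm u * unorm v)" for u v
    using mult_left_mono[OF unorm_umult_le[of v a] unorm_nonneg[of u]] by (simp add: mult_ac)
  then show "valid_trep (trmult r a)"
    unfolding valid_trep_def trmult_def by (intro summable_comparison_test'[OF s, of 0]) simp
qed

text \<open>Transfers \<open>tdist\<close>, a supremum over scalar forms of norm at most 1, to
  vector values: compose \<open>B\<close> with a functional norming the difference and divide by
  \<open>K\<close>.\<close>

lemma norm_tsum_diff_le:
  fixes B :: "'a::cbanach_algebra unitz \<Rightarrow> 'a unitz \<Rightarrow> 'y::cbanach"
  assumes B: "bdd_bilinear K B" and r: "valid_trep r" and s: "valid_trep s"
  shows "norm (tsum B r - tsum B s) \<le> K * tdist r s"
proof (cases "K = 0")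
  case True
  then have "B u v = 0" for u v
    using bdd_bilinear_norm[OF B, of u v] by simp
  then show ?thesis
    using True by (simp add: tsum_def)
next
  case False
  then have K: "K > 0"
    using bdd_bilinear_nonneg[OF B] by simp
  obtain f where f: "clinear f" "\<And>y. cmod (f y) \<le> norm y"
    and fn: "f (tsum B r - tsum B s) = norm (tsum B r - tsum B s)"
    using norming_functional by blast
  define g where "g y = of_real (1 / K) * f y" for y
  have g: "clinear g" and gb: "norm (g y) \<le> norm y * (1 / K)" for y
    using f(1) f(2)[of y] K
    by (auto simp: g_def clinear_def distrib_left scaleC_complex_def norm_divide field_simps)
  have "bdd_bilinear 1 (\<lambda>u v. g (B u v))"
    using bdd_bilinear_compose[OF B g gb] K by simp
  then have mem: "(\<lambda>u v. g (B u v)) \<in> bbforms1"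
    by (simp add: bbforms1_eq)
  have "bounded_linear g"
    unfolding g_def using bounded_linear_functional[OF f] by (intro bounded_linear_const_mult)
  then have "tval r (\<lambda>u v. g (B u v)) - tval s (\<lambda>u v. g (B u v)) = g (tsum B r - tsum B s)"
    using B r s by (simp add: tval_eq tsum_bounded_linear linear_diff bounded_linear.linear)
  also have "cmod \<dots> = norm (tsum B r - tsum B s) / K"
    using K by (simp add: g_def fn norm_divide norm_mult)
  finally have "norm (tsum B r - tsum B s) / K
      = cmod (tval r (\<lambda>u v. g (B u v)) - tval s (\<lambda>u v. g (B u v)))" by simp
  also have "\<dots> \<le> tdist r s"
    unfolding tdist_def
  proof (rule cSUP_upper[OF mem])
    \<comment> \<open>The real supremum in \<open>tdist\<close> dominates its members only once the
      family is known to be bounded above.\<close>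
    have "cmod (tval r \<phi> - tval s \<phi>) \<le> rep_norm r + rep_norm s" if "\<phi> \<in> bbforms1" for \<phi>
      using norm_tsum_le[of 1 \<phi> r] norm_tsum_le[of 1 \<phi> s] that r s
      by (auto simp: bbforms1_eq tval_eq intro: norm_triangle_le_diff)
    then show "bdd_above ((\<lambda>\<phi>. cmod (tval r \<phi> - tval s \<phi>)) ` bbforms1)"
      by (rule bdd_aboveI2)
  qed
  finally show ?thesis
    using K by (simp add: field_simps)
qed

lemma tdist_nonneg:
  assumes "valid_trep r" "valid_trep s"
  shows "0 \<le> tdist r s"
proof -
  have "bdd_bilinear 1 (\<lambda>_ _. 0 :: complex)"
    by (rule bdd_bilinearI) simp_all
  from norm_tsum_diff_le[OF this assms] show ?thesis
    by (simp add: tsum_def)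
qed

text \<open>Symmetry is tested on scalar forms; a functional norming the difference of the two sums
  carries it over to vector values.\<close>

lemma tsum_tflip:
  assumes B: "bdd_bilinear K B" and r: "valid_trep r" and sym: "tsymmetric r"
  shows "tsum B (tflip r) = tsum B r"
proof -
  have r': "valid_trep (tflip r)"
    using r by (simp add: valid_trep_def tflip_def mult.commute)
  obtain f where f: "clinear f" "\<And>y. cmod (f y) \<le> norm y"
    and fn: "f (tsum B (tflip r) - tsum B r) = norm (tsum B (tflip r) - tsum B r)"
    using norming_functional by blast
  have "bdd_bilinear K (\<lambda>u v. f (B u v))"
    using bdd_bilinear_compose[OF B f(1), of 1] f(2) by simp
  then have "tsum (\<lambda>u v. f (B u v)) (tflip r) = tsum (\<lambda>u v. f (B u v)) r"
    using sym by (auto simp: tsymmetric_def bbforms_eq tval_eq)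
  then have "f (tsum B (tflip r) - tsum B r) = 0"
    using B r r' bounded_linear_functional[OF f]
    by (simp add: tsum_bounded_linear linear_diff bounded_linear.linear)
  then show ?thesis
    using fn by simp
qed

text \<open>Flipping \<open>a t - t a\<close> for symmetric \<open>t = \<Sum> u\<^sub>n \<otimes> v\<^sub>n\<close> shows that
\<open>\<Sum> (u\<^sub>n a \<otimes> v\<^sub>n - u\<^sub>n \<otimes> a v\<^sub>n)\<close> is as small as \<open>a t - t a\<close>.\<close>

lemma norm_tsum_flip_le:
  assumes B: "bdd_bilinear K B" and r: "valid_trep r" and sym: "tsymmetric r"
  shows "norm (tsum (\<lambda>u v. B (umult u a) v - B u (umult a v)) r)
    \<le> K * tdist (tlmult a r) (trmult r a)"
proof -
  let ?B' = "\<lambda>u v. B v u"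
  note B' = bdd_bilinear_swap[OF B]
  have "tsum (\<lambda>u v. B (umult u a) v - B u (umult a v)) r
      = tsum (\<lambda>u v. B (umult u a) v - B u (umult a v)) (tflip r)"
    by (rule tsum_tflip[OF bdd_bilinear_diff r sym, symmetric]) (rule bdd_bilinear_umult[OF B])+
  also have "\<dots> = tsum (\<lambda>u v. ?B' u (umult v a) - ?B' (umult a u) v) r"
    by (simp add: tsum_def tflip_def)
  also have "\<dots> = tsum (\<lambda>u v. ?B' u (umult v a)) r - tsum (\<lambda>u v. ?B' (umult a u) v) r"
    by (rule tsum_diff[OF _ _ r]) (rule bdd_bilinear_umult[OF B'])+
  also have "\<dots> = tsum ?B' (trmult r a) - tsum ?B' (tlmult a r)"
    by (simp add: tsum_def tlmult_def trmult_def)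
  finally show ?thesis
    using norm_tsum_diff_le[OF B' valid_trep_umult(1)[OF r] valid_trep_umult(2)[OF r], of a a]
    by (simp add: norm_minus_commute)
qed

section \<open>Banach bimodules\<close>

definition unitz_embed :: "'a::cbanach_algebra \<Rightarrow> 'a unitz" where
  "unitz_embed a = (a, 0)"

locale banach_bimod =
  fixes la :: "'a::cbanach_algebra \<Rightarrow> 'x::cbanach \<Rightarrow> 'x" and ra :: "'x \<Rightarrow> 'a \<Rightarrow> 'x"
  assumes bimod: "banach_bimodule la ra"
begin

lemma la_add_left: "la (a + b) x = la a x + la b x"
  and la_add_right: "la a (x + y) = la a x + la a y"
  and la_scale_left: "la (scaleC c a) x = scaleC c (la a x)"
  and la_scale_right: "la a (scaleC c x) = scaleC c (la a x)"
  and ra_add_left: "ra (x + y) a = ra x a + ra y a"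
  and ra_add_right: "ra x (a + b) = ra x a + ra x b"
  and ra_scale_right: "ra x (scaleC c a) = scaleC c (ra x a)"
  and ra_scale_left: "ra (scaleC c x) a = scaleC c (ra x a)"
  and la_la: "la a (la b x) = la (a * b) x"
  and ra_ra: "ra (ra x a) b = ra x (a * b)"
  and ra_la: "ra (la a x) b = la a (ra x b)"
  and norm_la: "norm (la a x) \<le> norm a * norm x"
  and norm_ra: "norm (ra x a) \<le> norm x * norm a"
  using bimod unfolding banach_bimodule_def by (simp_all only:)

lemmas bimod_simps = la_add_left la_add_right la_scale_left la_scale_right ra_add_left ra_add_right
  ra_scale_right ra_scale_left la_la ra_ra ra_la

lemma bounded_bilinear_la: "bounded_bilinear la"
proof
  show "la (r *\<^sub>R a) x = r *\<^sub>R la a x" "la a (r *\<^sub>R x) = r *\<^sub>R la a x" for r a x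
    by (simp_all add: scaleC_of_real[symmetric] bimod_simps)
  show "\<exists>K. \<forall>a x. norm (la a x) \<le> norm a * norm x * K"
    using norm_la by (intro exI[of _ 1]) simp
qed (simp_all add: bimod_simps)

lemma bounded_bilinear_ra: "bounded_bilinear ra"
proof
  show "ra (r *\<^sub>R x) a = r *\<^sub>R ra x a" "ra x (r *\<^sub>R a) = r *\<^sub>R ra x a" for r a x
    by (simp_all add: scaleC_of_real[symmetric] bimod_simps)
  show "\<exists>K. \<forall>x a. norm (ra x a) \<le> norm x * norm a * K"
    using norm_ra by (intro exI[of _ 1]) simp
qed (simp_all add: bimod_simps)

lemmas la_diff_left = bounded_bilinear.diff_left[OF bounded_bilinear_la]
  and la_diff_right = bounded_bilinear.diff_right[OF bounded_bilinear_la]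
  and ra_diff_left = bounded_bilinear.diff_left[OF bounded_bilinear_ra]
  and la_zero_left = bounded_bilinear.zero_left[OF bounded_bilinear_la]
  and ra_zero_right = bounded_bilinear.zero_right[OF bounded_bilinear_ra]

lemma ula_umult: "ula la (umult u v) x = ula la u (ula la v x)"
  by (simp add: ula_def umult_def bimod_simps scaleC_add_right scaleC_scaleC algebra_simps)

lemma ura_umult: "ura ra x (umult u v) = ura ra (ura ra x u) v"
  by (simp add: ura_def umult_def bimod_simps scaleC_add_right scaleC_scaleC algebra_simps)

lemma ura_ula: "ura ra (ula la u x) v = ula la u (ura ra x v)"
  by (simp add: ula_def ura_def bimod_simps scaleC_add_right scaleC_scaleC algebra_simps)

lemma ula_add_left: "ula la (uadd u v) x = ula la u x + ula la v x"
  and ula_add_right: "ula la u (x + y) = ula la u x + ula la u y"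
  and ula_scale_left: "ula la (uscale c u) x = scaleC c (ula la u x)"
  and ula_scale_right: "ula la u (scaleC c x) = scaleC c (ula la u x)"
  and ula_diff_right: "ula la u (x - y) = ula la u x - ula la u y"
  and ula_diff_left: "ula la (usub u v) x = ula la u x - ula la v x"
  and ula_unit: "ula la (0, 1) x = x"
  and ula_embed: "ula la (unitz_embed a) x = la a x"
proof -
  have "scaleC (c - d) x = scaleC c x - scaleC d x" for c d and x :: 'x
    using scaleC_add_left[of "c - d" d x] by simp
  then show "ula la (usub u v) x = ula la u x - ula la v x"
    by (simp add: ula_def usub_def la_diff_left)
qed (simp_all add: ula_def uadd_def uscale_def unitz_embed_def bimod_simps scaleC_add_left
    scaleC_add_right scaleC_scaleC scaleC_one scaleC_diff_right la_diff_right la_zero_left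
    mult.commute)

lemma ura_add_left: "ura ra (x + y) u = ura ra x u + ura ra y u"
  and ura_add_right: "ura ra x (uadd u v) = ura ra x u + ura ra x v"
  and ura_scale_left: "ura ra (scaleC c x) u = scaleC c (ura ra x u)"
  and ura_scale_right: "ura ra x (uscale c u) = scaleC c (ura ra x u)"
  and ura_diff_left: "ura ra (x - y) u = ura ra x u - ura ra y u"
  and ura_embed: "ura ra x (unitz_embed a) = ra x a"
  by (simp_all add: ura_def uadd_def uscale_def unitz_embed_def bimod_simps scaleC_add_left
    scaleC_add_right scaleC_scaleC scaleC_diff_right ra_diff_left ra_zero_right mult.commute)

lemma ra_ula: "ra (ula la u x) a = ula la u (ra x a)"
  using ura_ula[of u x "unitz_embed a"] by (simp add: ura_embed)

lemma norm_ula: "norm (ula la u x) \<le> unorm u * norm x"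
  unfolding ula_def unorm_def distrib_right
  by (intro norm_triangle_mono norm_la) (simp add: norm_scaleC)

lemma norm_ura: "norm (ura ra x u) \<le> norm x * unorm u"
  unfolding ura_def unorm_def distrib_left
  by (intro norm_triangle_mono norm_ra) (simp add: norm_scaleC mult.commute)

section \<open>The maps psi_x and the product map\<close>

abbreviation psi_form :: "'x \<Rightarrow> 'a unitz \<Rightarrow> 'a unitz \<Rightarrow> 'x" where
  "psi_form x u v \<equiv> ura ra (ula la u x) v"

lemma bdd_bilinear_psi_form: "bdd_bilinear (norm x) (psi_form x)"
proof (rule bdd_bilinearI)
  show "norm (psi_form x u v) \<le> norm x * unorm u * unorm v" for u v
    using norm_ura[of "ula la u x" v] mult_right_mono[OF norm_ula[of u x] unorm_nonneg[of v]]
    by (simp add: mult.commute)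
qed (simp_all add: ula_add_left ura_add_left ura_add_right ula_scale_left
    ura_scale_left ura_scale_right)

lemma psi_eq: "psi la ra x r = tsum (psi_form x) r"
  by (simp add: psi_def tsum_def)

lemma norm_psi_le: "valid_trep r \<Longrightarrow> norm (psi la ra x r) \<le> norm x * rep_norm r"
  unfolding psi_eq by (rule norm_tsum_le[OF bdd_bilinear_psi_form])

lemma psi_diff:
  assumes "valid_trep r"
  shows "psi la ra (x - y) r = psi la ra x r - psi la ra y r"
  unfolding psi_eq tsum_diff[OF bdd_bilinear_psi_form bdd_bilinear_psi_form assms, symmetric]
  by (simp add: tsum_def ula_diff_right ura_diff_left)

text \<open>The commutator of \<open>a\<close> with \<open>psi_x(r)\<close> is \<open>psi_x\<close>
  evaluated at \<open>a r - r a\<close>.\<close>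

lemma psi_almost_central:
  assumes r: "valid_trep r"
  shows "norm (la a (psi la ra x r) - ra (psi la ra x r) a)
    \<le> norm x * tdist (tlmult (unitz_embed a) r) (trmult r (unitz_embed a))"
proof -
  have "la a (psi la ra x r) = tsum (\<lambda>u v. la a (psi_form x u v)) r"
    unfolding psi_eq
    by (rule tsum_bounded_linear[symmetric, OF bdd_bilinear_psi_form
          bounded_bilinear.bounded_linear_right[OF bounded_bilinear_la] r])
  moreover have "ra (psi la ra x r) a = tsum (\<lambda>u v. ra (psi_form x u v) a) r"
    unfolding psi_eq
    by (rule tsum_bounded_linear[symmetric, OF bdd_bilinear_psi_form
          bounded_bilinear.bounded_linear_left[OF bounded_bilinear_ra] r])
  ultimately show ?thesis
    using norm_tsum_diff_le[OF bdd_bilinear_psi_form valid_trep_umult(1)[OF r] valid_trep_umult(2)[OF r],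
        of x "unitz_embed a" "unitz_embed a"]
    by (simp add: tsum_def tlmult_def trmult_def ula_umult ura_umult ura_ula ra_ula ula_embed ura_embed)
qed

text \<open>At \<open>u\<close> and \<open>v\<close> the form of \<open>a x - x a\<close> is
  \<open>(u a) x v - u x (a v)\<close>, the expression controlled by flipping a symmetric tensor.
  The bound depends on \<open>x\<close> only through its norm, which gives uniformity over bounded
  sets.\<close>

lemma norm_psi_commutator_le:
  assumes r: "valid_trep r" "tsymmetric r"
  shows "norm (psi la ra (la a x - ra x a) r)
    \<le> norm x * tdist (tlmult (unitz_embed a) r) (trmult r (unitz_embed a))"
  using norm_tsum_flip_le[OF bdd_bilinear_psi_form[of x] r, of "unitz_embed a"]
  by (simp add: psi_eq ula_umult ura_umult ura_ula ra_ula ula_embed ura_embed ura_diff_left ula_diff_right)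

lemma bdd_bilinear_mult: "bdd_bilinear (norm x) (\<lambda>u v. ula la (umult u v) x)"
proof (rule bdd_bilinearI)
  show "norm (ula la (umult u v) x) \<le> norm x * unorm u * unorm v" for u v
    using norm_ula[of "umult u v" x] mult_right_mono[OF unorm_umult_le[of u v] norm_ge_zero[of x]]
    by (simp add: mult_ac)
qed (simp_all add: umult_uadd_left umult_uadd_right umult_uscale_left
    umult_uscale_right ula_add_left ula_scale_left)

text \<open>Writes the action of \<open>tpi r\<close> as a sum over the representation that defines
  \<open>psi\<close>, so that the two can be compared term by term.\<close>

lemma ula_tpi:
  assumes r: "valid_trep r"
  shows "ula la (tpi r) x = tsum (\<lambda>u v. ula la (umult u v) x) r"
proof -
  let ?w = "\<lambda>n. umult (fst (r n)) (snd (r n))"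
  \<comment> \<open>\<open>tpi\<close> sums the two components separately, and each is dominated by
    the \<open>unorm\<close> of the product.\<close>
  have w: "norm (fst (?w n)) \<le> unorm (fst (r n)) * unorm (snd (r n))"
    "norm (snd (?w n)) \<le> unorm (fst (r n)) * unorm (snd (r n))" for n
    using unorm_umult_le[of "fst (r n)" "snd (r n)"] norm_ge_zero[of "fst (?w n)"]
      norm_ge_zero[of "snd (?w n)"] by (simp_all only: unorm_def[of "?w n"])
  have s1: "summable (\<lambda>n. fst (?w n))" and s2: "summable (\<lambda>n. snd (?w n))"
    using r w unfolding valid_trep_def by (blast intro: summable_comparison_test')+
  have bl2: "bounded_linear (\<lambda>c. scaleC c x)"
    by (rule bounded_linear_intro[where K = "norm x"])
      (simp_all add: scaleC_add_left norm_scaleC scaleC_scaleC scaleC_of_real[symmetric]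
        scaleC_complex_def)
  note bl1 = bounded_bilinear.bounded_linear_left[OF bounded_bilinear_la, of x]
  have "ula la (tpi r) x = (\<Sum>n. la (fst (?w n)) x) + (\<Sum>n. scaleC (snd (?w n)) x)"
    by (simp add: ula_def tpi_def bounded_linear.suminf[OF bl1 s1] bounded_linear.suminf[OF bl2 s2])
  also have "\<dots> = (\<Sum>n. la (fst (?w n)) x + scaleC (snd (?w n)) x)"
    by (rule suminf_add[OF bounded_linear.summable[OF bl1 s1] bounded_linear.summable[OF bl2 s2]])
  finally show ?thesis
    by (simp add: tsum_def ula_def)
qed

text \<open>Testing the approximate identity property at the adjoined unit \<open>(0, 1)\<close>
  measures the distance from \<open>tpi r\<close> to 1, hence gives a bound uniform for
  \<open>x\<close> in bounded sets.\<close>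

lemma norm_ula_tpi_minus_le:
  "norm (ula la (tpi r) x - x) \<le> unorm (usub (umult (tpi r) (0, 1)) (0, 1)) * norm x"
proof -
  have "umult (tpi r) (0, 1) = tpi r"
    by (simp add: umult_def scaleC_one)
  then show ?thesis
    using norm_ula[of "usub (tpi r) (0, 1)" x] by (simp add: ula_diff_left ula_unit)
qed

section \<open>The map Phi_D and the Lie identity\<close>

abbreviation Phi_form :: "('a \<Rightarrow> 'x) \<Rightarrow> 'a unitz \<Rightarrow> 'a unitz \<Rightarrow> 'x" where
  "Phi_form T u v \<equiv> ula la u (T (fst v))"

lemma bdd_bilinear_Phi_form:
  assumes T: "clinear T" and bd: "\<And>a. norm (T a) \<le> norm a * K" and K: "0 \<le> K"
  shows "bdd_bilinear K (Phi_form T)"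
proof (rule bdd_bilinearI)
  show "norm (Phi_form T u v) \<le> K * unorm u * unorm v" for u v
  proof -
    have "norm (Phi_form T u v) \<le> unorm u * norm (T (fst v))"
      by (rule norm_ula)
    also have "\<dots> \<le> unorm u * (unorm v * K)"
      using K by (intro mult_left_mono order_trans[OF bd] mult_right_mono) (auto simp: unorm_def)
    finally show ?thesis by (simp add: mult_ac)
  qed
qed (simp_all add: ula_add_left ula_add_right ula_scale_left ula_scale_right
    fst_uadd fst_uscale clinear_add[OF T] clinear_scale[OF T])

lemma Phi_eq: "Phi la T r = tsum (Phi_form T) r"
  by (simp add: Phi_def tsum_def)

text \<open>The Lie identity turns \<open>u D(v a)\<close> into \<open>u D(v) a + u v D(a) - u D(a) v\<close> up to the
flip term \<open>u D(a v) - u a D(v)\<close>.\<close>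

lemma Lie_derivation_approx_inner:
  assumes D: "clinear D" and bd: "\<And>a. norm (D a) \<le> norm a * K" and K: "0 \<le> K"
    and lie: "is_lie_derivation la ra D"
    and r: "valid_trep r" "tsymmetric r"
  defines "x \<equiv> Phi la D r"
  shows "norm (D a - (la a x - ra x a) - psi la ra (D a) r)
    \<le> 2 * K * tdist (tlmult (unitz_embed a) r) (trmult r (unitz_embed a))
      + unorm (usub (umult (tpi r) (0, 1)) (0, 1)) * norm (D a)"
proof -
  let ?a = "unitz_embed a" and ?B = "Phi_form D"
  let ?flip = "\<lambda>u v. ?B (umult u ?a) v - ?B u (umult ?a v)"
  note B = bdd_bilinear_Phi_form[OF D bd K]
  note Bl = bdd_bilinear_umult[OF B]
  note bl_la = bounded_bilinear.bounded_linear_right[OF bounded_bilinear_la]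
  note bl_ra = bounded_bilinear.bounded_linear_left[OF bounded_bilinear_ra]
  have ra_clinear: "clinear (\<lambda>x. ra x a)"
    by (simp add: clinear_def bimod_simps)
  have B_ra: "bdd_bilinear (norm a * K) (\<lambda>u v. ra (?B u v) a)"
    by (rule bdd_bilinear_compose[OF B ra_clinear norm_ra]) simp
  have expand: "?B u (umult v ?a)
      = ra (?B u v) a - (psi_form (D a) u v - ula la (umult u v) (D a)) - ?flip u v" for u v
  proof -
    obtain b \<beta> where v: "v = (b, \<beta>)" by (cases v)
    have "D (b * a) = D (a * b) + ra (D b) a + la b (D a) - ra (D a) b - la a (D b)"
    proof -
      have "D (b * a) = D (a * b + (b * a - a * b))" by simp
      also have "\<dots> = D (a * b) + D (b * a - a * b)"
        by (rule clinear_add[OF D])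
      finally show ?thesis
        using lie by (simp add: is_lie_derivation_def)
    qed
    \<comment> \<open>The scalar part of \<open>v\<close> adds the same term
      \<open>\<beta> a\<close> to both products and the same term \<open>\<beta> D(a)\<close> to
      \<open>v D(a)\<close> and \<open>D(a) v\<close>, so all of it cancels.\<close>
    then have "D (fst (umult v ?a))
        = D (fst (umult ?a v)) + ra (D (fst v)) a + ula la v (D a) - ura ra (D a) v - la a (D (fst v))"
      by (simp add: v umult_def unitz_embed_def clinear_add[OF D] ula_def ura_def)
    then show ?thesis
      by (simp add: ula_umult ula_embed ula_diff_right ula_add_right ura_ula
          ura_embed[symmetric])
  qed
  have "tsum ?B (tlmult ?a r) = la a x"
    unfolding x_def Phi_eq tsum_bounded_linear[OF B bl_la r(1), symmetric]
    by (simp add: tsum_def tlmult_def ula_umult ula_embed)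
  moreover have "tsum ?B (trmult r ?a)
      = ra x a - (psi la ra (D a) r - ula la (tpi r) (D a)) - tsum ?flip r"
  proof -
    have "tsum ?B (trmult r ?a) = tsum (\<lambda>u v. ?B u (umult v ?a)) r"
      by (simp add: tsum_def trmult_def)
    also have "\<dots> = tsum (\<lambda>u v. ra (?B u v) a - (psi_form (D a) u v - ula la (umult u v) (D a))
        - ?flip u v) r"
      by (simp only: expand)
    also have "\<dots> = tsum (\<lambda>u v. ra (?B u v) a - (psi_form (D a) u v - ula la (umult u v) (D a))) r
        - tsum ?flip r"
      by (rule tsum_diff[OF bdd_bilinear_diff[OF B_ra bdd_bilinear_diff[OF bdd_bilinear_psi_form
              bdd_bilinear_mult]] bdd_bilinear_diff[OF Bl(2) Bl(3)] r(1)])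
    also have "tsum (\<lambda>u v. ra (?B u v) a - (psi_form (D a) u v - ula la (umult u v) (D a))) r
        = tsum (\<lambda>u v. ra (?B u v) a) r - tsum (\<lambda>u v. psi_form (D a) u v - ula la (umult u v) (D a)) r"
      by (rule tsum_diff[OF B_ra bdd_bilinear_diff[OF bdd_bilinear_psi_form bdd_bilinear_mult] r(1)])
    also have "tsum (\<lambda>u v. ra (?B u v) a) r = ra x a"
      unfolding x_def Phi_eq by (rule tsum_bounded_linear[OF B bl_ra r(1)])
    also have "tsum (\<lambda>u v. psi_form (D a) u v - ula la (umult u v) (D a)) r
        = psi la ra (D a) r - ula la (tpi r) (D a)"
      unfolding psi_eq ula_tpi[OF r(1)]
      by (rule tsum_diff[OF bdd_bilinear_psi_form bdd_bilinear_mult r(1)])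
    finally show ?thesis .
  qed
  \<comment> \<open>The error splits into the flip term, the value at \<open>a r - r a\<close>, and
    the defect of \<open>tpi r\<close> from 1; each of the first two contributes one
    \<open>K * tdist\<close>.\<close>
  ultimately have eq: "D a - (la a x - ra x a) - psi la ra (D a) r
      = tsum ?flip r - (tsum ?B (tlmult ?a r) - tsum ?B (trmult r ?a))
        - (ula la (tpi r) (D a) - D a)"
    by simp
  have "norm (tsum ?flip r - (tsum ?B (tlmult ?a r) - tsum ?B (trmult r ?a))
        - (ula la (tpi r) (D a) - D a))
      \<le> norm (tsum ?flip r) + norm (tsum ?B (tlmult ?a r) - tsum ?B (trmult r ?a))
        + norm (ula la (tpi r) (D a) - D a)"
    by (rule order_trans[OF norm_triangle_ineq4 add_right_mono[OF norm_triangle_ineq4]])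
  then show ?thesis
    unfolding eq
    using norm_tsum_diff_le[OF B valid_trep_umult(1)[OF r(1)] valid_trep_umult(2)[OF r(1)], of ?a ?a]
      norm_tsum_flip_le[OF B r, of ?a] norm_ula_tpi_minus_le[of r "D a"]
    by linarith
qed

text \<open>Each term equals \<open>- u (v y - y v)\<close> and tends to 0 for fixed
  \<open>u\<close> and \<open>v\<close>. The terms are dominated by a summable sequence, as
  \<open>y\<close> is eventually bounded, so Tannery's theorem lets the limit pass through the
  sum.\<close>

lemma psi_minus_tpi_tendsto_0:
  assumes r: "valid_trep r" and F: "F \<noteq> bot"
    and bd: "eventually (\<lambda>i. norm (y i) \<le> N) F"
    and central: "\<And>a. ((\<lambda>i. la a (y i) - ra (y i) a) \<longlongrightarrow> 0) F"
  shows "((\<lambda>i. psi la ra (y i) r - ula la (tpi r) (y i)) \<longlongrightarrow> 0) F"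
proof -
  define T where "T n i = psi_form (y i) (fst (r n)) (snd (r n))
    - ula la (umult (fst (r n)) (snd (r n))) (y i)" for n i
  \<comment> \<open>The scalar part of \<open>v\<close> commutes with \<open>y i\<close>, so only
    its component in the algebra remains.\<close>
  have T: "T n i = - ula la (fst (r n)) (la (fst (snd (r n))) (y i) - ra (y i) (fst (snd (r n))))" for n i
    by (simp add: T_def ula_umult ura_ula ula_diff_right[symmetric])
      (simp add: ula_def ura_def ula_diff_right algebra_simps bimod_simps la_diff_right scaleC_diff_right scaleC_add_right)
  have T_le: "norm (T n i) \<le> 2 * norm (y i) * (unorm (fst (r n)) * unorm (snd (r n)))" for n i
    unfolding T_def
    using bdd_bilinear_norm[OF bdd_bilinear_diff[OF bdd_bilinear_psi_form[of "y i"]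
          bdd_bilinear_mult[of "y i"]], of "fst (r n)" "snd (r n)"]
    by (simp add: mult.assoc)
  have lim: "((\<lambda>i. norm (T n i)) \<longlongrightarrow> 0) F" for n
  proof (rule Lim_null_comparison)
    show "((\<lambda>i. unorm (fst (r n)) * norm (la (fst (snd (r n))) (y i) - ra (y i) (fst (snd (r n))))) \<longlongrightarrow> 0) F"
      by (intro tendsto_mult_right_zero tendsto_norm_zero central)
  qed (simp add: T norm_ula)
  have ev: "eventually (\<lambda>(n, i). norm (norm (T n i)) \<le> 2 * N * (unorm (fst (r n)) * unorm (snd (r n))))
      (at_top \<times>\<^sub>F F)"
  proof -
    have "eventually (\<lambda>p. norm (y (snd p)) \<le> N) (at_top \<times>\<^sub>F F)"
      using bd filterlim_snd by (rule eventually_compose_filterlim)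
    then show ?thesis
    proof (eventually_elim, clarsimp)
      fix n i assume "norm (y i) \<le> N"
      then show "norm (T n i) \<le> 2 * N * (unorm (fst (r n)) * unorm (snd (r n)))"
        by (intro order_trans[OF T_le] mult_right_mono) auto
    qed
  qed
  have sm: "summable (\<lambda>n. 2 * N * (unorm (fst (r n)) * unorm (snd (r n))))"
    using r by (simp add: valid_trep_def summable_mult)
  have sum_lim: "((\<lambda>i. \<Sum>n. norm (T n i)) \<longlongrightarrow> (\<Sum>n::nat. 0)) F"
    by (rule tannerys_theorem[OF lim ev sm F, THEN conjunct2, THEN conjunct2])
  have "norm (psi la ra (y i) r - ula la (tpi r) (y i)) \<le> (\<Sum>n. norm (T n i))" for i
  proof -
    note bb = bdd_bilinear_diff[OF bdd_bilinear_psi_form[of "y i"] bdd_bilinear_mult[of "y i"]]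
    have "psi la ra (y i) r - ula la (tpi r) (y i) = (\<Sum>n. T n i)"
      unfolding psi_eq ula_tpi[OF r] tsum_diff[OF bdd_bilinear_psi_form bdd_bilinear_mult r, symmetric]
      by (simp add: tsum_def T_def)
    also have "norm \<dots> \<le> (\<Sum>n. norm (T n i))"
      by (rule summable_norm) (use summable_norm_bdd_bilinear[OF bb r] in \<open>simp add: T_def\<close>)
    finally show ?thesis .
  qed
  then show ?thesis
    by (rule Lim_null_comparison[OF always_eventually[OF allI]]) (use sum_lim in simp)
qed

end

section \<open>Limits along nets\<close>

text \<open>The filter generated by the tails of the net, which turns net convergence into filter
  convergence.\<close>

definition net_filter :: "'l set \<Rightarrow> ('l \<Rightarrow> 'l \<Rightarrow> bool) \<Rightarrow> 'l filter" where
  "net_filter \<Lambda> le = (INF i\<in>\<Lambda>. principal {j\<in>\<Lambda>. le i j})"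

lemma eventually_net_filter:
  assumes "directed_set \<Lambda> le"
  shows "eventually P (net_filter \<Lambda> le) \<longleftrightarrow> (\<exists>i\<in>\<Lambda>. \<forall>j\<in>\<Lambda>. le i j \<longrightarrow> P j)"
proof -
  have "\<exists>k\<in>\<Lambda>. principal {l\<in>\<Lambda>. le k l} \<le> inf (principal {l\<in>\<Lambda>. le i l}) (principal {l\<in>\<Lambda>. le j l})"
    if ij: "i \<in> \<Lambda>" "j \<in> \<Lambda>" for i j
  proof -
    obtain k where "k \<in> \<Lambda>" "le i k" "le j k"
      using assms ij unfolding directed_set_def by blast
    with ij assms have "{l\<in>\<Lambda>. le k l} \<subseteq> {l\<in>\<Lambda>. le i l} \<inter> {l\<in>\<Lambda>. le j l}"
      unfolding directed_set_def by blast
    with \<open>k \<in> \<Lambda>\<close> show ?thesis by auto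
  qed
  moreover have "\<Lambda> \<noteq> {}"
    using assms unfolding directed_set_def by blast
  ultimately have "eventually P (net_filter \<Lambda> le)
      \<longleftrightarrow> (\<exists>i\<in>\<Lambda>. eventually P (principal {j\<in>\<Lambda>. le i j}))"
    unfolding net_filter_def by (intro eventually_INF_base)
  then show ?thesis
    unfolding eventually_principal by blast
qed

text \<open>Reflexivity puts each index into its own tail, so no tail is empty.\<close>

lemma net_filter_neq_bot:
  assumes "directed_set \<Lambda> le"
  shows "net_filter \<Lambda> le \<noteq> bot"
proof -
  have "\<forall>i\<in>\<Lambda>. le i i"
    using assms unfolding directed_set_def by blast
  then show ?thesis
    unfolding trivial_limit_def eventually_net_filter[OF assms] by blast
qed

lemma eventually_net_filter_carrier:
  assumes "directed_set \<Lambda> le"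
  shows "eventually (\<lambda>i. i \<in> \<Lambda>) (net_filter \<Lambda> le)"
proof -
  have "\<Lambda> \<noteq> {}"
    using assms unfolding directed_set_def by blast
  then show ?thesis
    unfolding eventually_net_filter[OF assms] by blast
qed

lemma net_to_zero_iff:
  "directed_set \<Lambda> le \<Longrightarrow> net_to_zero \<Lambda> le f \<longleftrightarrow> (f \<longlongrightarrow> 0) (net_filter \<Lambda> le)"
  by (simp add: net_to_zero_def tendsto_iff eventually_net_filter)

text \<open>How far \<open>j\<close> must go may depend on \<open>i\<close>: one good
  \<open>i\<close> serves as a common centre for comparing all later values. This matches the
  estimate for \<open>y\<close>, which is not symmetric in its two indices.\<close>

lemma convergent_filter_if_iterated_Cauchy:
  fixes f :: "'i \<Rightarrow> 'y::banach"
  assumes F: "F \<noteq> bot"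
    and cauchy: "\<And>e. e > 0 \<Longrightarrow> eventually (\<lambda>i. eventually (\<lambda>j. norm (f i - f j) < e) F) F"
  obtains l where "(f \<longlongrightarrow> l) F"
proof -
  have "cauchy_filter (filtermap f F)"
    unfolding cauchy_filter_metric_filtermap
  proof (intro allI impI)
    fix e :: real assume "e > 0"
    then obtain i where "eventually (\<lambda>j. norm (f i - f j) < e / 2) F"
      using eventually_happens'[OF F cauchy[of "e / 2"]] by auto
    moreover have "dist (f x) (f y) < e" if "norm (f i - f x) < e / 2" "norm (f i - f y) < e / 2" for x y
      using that by (metis dist_commute dist_norm dist_triangle_half_r)
    ultimately show "\<exists>P. eventually P F \<and> (\<forall>x y. P x \<and> P y \<longrightarrow> dist (f x) (f y) < e)"
      by blast
  qed
  then have "\<exists>l. filtermap f F \<le> nhds l"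
    using cauchy_filter_complete_converges[of "filtermap f F" UNIV] F
    by (simp add: complete_UNIV filtermap_bot_iff)
  then show ?thesis
    using that by (auto simp: filterlim_def)
qed

section \<open>Convergence of the central part and the decomposition\<close>

theorem theorem6p4:
  fixes \<Lambda> :: "'l set" and le :: "'l \<Rightarrow> 'l \<Rightarrow> bool"
    and t :: "'l \<Rightarrow> 'a::cbanach_algebra trep"
    and la :: "'a \<Rightarrow> 'x::cbanach \<Rightarrow> 'x" and ra :: "'x \<Rightarrow> 'a \<Rightarrow> 'x"
    and D :: "'a \<Rightarrow> 'x"
  assumes diag: "symm_approx_diag \<Lambda> le t"
    and bimod: "banach_bimodule la ra"
    and psi_bdd: "\<forall>x. \<exists>M. \<forall>i\<in>\<Lambda>. norm (psi la ra x (t i)) \<le> M"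
    and D_lin: "clinear D" and D_bdd: "bounded_map D"
    and D_lie: "is_lie_derivation la ra D"
    and Phi_bdd: "\<exists>M. \<forall>i\<in>\<Lambda>. norm (Phi la D (t i)) \<le> M"
  shows "\<exists>d \<tau>. clinear d \<and> bounded_map d \<and> is_derivation la ra d \<and>
           clinear \<tau> \<and> bounded_map \<tau> \<and> (\<forall>a. \<tau> a \<in> centre la ra) \<and>
           (\<forall>a b. \<tau> (a * b - b * a) = 0) \<and>
           (\<forall>a. D a = d a + \<tau> a)"
proof -
  interpret banach_bimod la ra
    by unfold_locales (fact bimod)
  define F where "F = net_filter \<Lambda> le"
  define x where "x i = Phi la D (t i)" for i
  define y where "y a i = psi la ra (D a) (t i)" for a i
  define \<delta> where "\<delta> a i = tdist (tlmult (unitz_embed a) (t i)) (trmult (t i) (unitz_embed a))" for a i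
  define p where "p i = unorm (usub (umult (tpi (t i)) (0, 1)) (0, 1))" for i
  define c where "c a i = la a (x i) - ra (x i) a" for a i
  define e where "e a i = D a - c a i - y a i" for a i
  have dir: "directed_set \<Lambda> le" and t: "\<And>i. i \<in> \<Lambda> \<Longrightarrow> valid_trep (t i)" "\<And>i. i \<in> \<Lambda> \<Longrightarrow> tsymmetric (t i)"
    and \<delta>0: "(\<delta> a \<longlongrightarrow> 0) F" and p0: "(p \<longlongrightarrow> 0) F" for a
    using diag by (auto simp: symm_approx_diag_def F_def \<delta>_def[abs_def] p_def[abs_def] net_to_zero_iff unitz_embed_def)
  have F: "F \<noteq> bot" and in\<Lambda>: "eventually (\<lambda>i. i \<in> \<Lambda>) F"
    using dir by (simp_all add: F_def net_filter_neq_bot eventually_net_filter_carrier)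
  \<comment> \<open>\<open>bounded_map\<close> does not fix the sign of its constant, so the maximum
    with 0 is taken.\<close>
  obtain K where K: "norm (D a) \<le> norm a * K" "0 \<le> K" for a
  proof -
    obtain K where "norm (D a) \<le> norm a * K" for a
      using D_bdd by (auto simp: bounded_map_def)
    then have "norm (D a) \<le> norm a * max K 0" for a
      by (rule order_trans) (simp add: mult_left_mono)
    then show ?thesis by (rule that) simp
  qed
  obtain M where M: "norm (x i) \<le> M" if "i \<in> \<Lambda>" for i
    using Phi_bdd by (auto simp: x_def)
  have e0: "(e a \<longlongrightarrow> 0) F" for a
  proof (rule Lim_null_comparison)
    show "eventually (\<lambda>i. norm (e a i) \<le> 2 * K * \<delta> a i + p i * norm (D a)) F"
      using in\<Lambda>
      by eventually_elim (unfold e_def c_def y_def x_def \<delta>_def p_def,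
          rule Lie_derivation_approx_inner[OF D_lin K D_lie t])
    show "((\<lambda>i. 2 * K * \<delta> a i + p i * norm (D a)) \<longlongrightarrow> 0) F"
      by (intro tendsto_add_zero tendsto_mult_right_zero tendsto_mult_left_zero \<delta>0 p0)
  qed
  have y_central: "((\<lambda>i. la b (y a i) - ra (y a i) b) \<longlongrightarrow> 0) F" for a b
  proof (rule Lim_null_comparison)
    show "eventually (\<lambda>i. norm (la b (y a i) - ra (y a i) b) \<le> norm (D a) * \<delta> b i) F"
      using in\<Lambda> by eventually_elim (unfold y_def \<delta>_def, rule psi_almost_central[OF t(1)])
    show "((\<lambda>i. norm (D a) * \<delta> b i) \<longlongrightarrow> 0) F"
      by (intro tendsto_mult_right_zero \<delta>0)
  qed
  have "\<exists>l. (y a \<longlongrightarrow> l) F" for a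
  proof -
    obtain N where N: "norm (y a i) \<le> N" if "i \<in> \<Lambda>" for i
      using psi_bdd by (force simp: y_def)
    \<comment> \<open>\<open>R i j\<close> collects what vanishes as \<open>j\<close> grows with
      \<open>i\<close> fixed; the factor \<open>rep_norm (t i)\<close> may be unbounded in
      \<open>i\<close>.\<close>
    define R where "R i j = norm (psi la ra (y a j) (t i) - ula la (tpi (t i)) (y a j))
      + norm (e a j) * rep_norm (t i)" for i j
    have R0: "((\<lambda>j. R i j) \<longlongrightarrow> 0) F" if "i \<in> \<Lambda>" for i
      unfolding R_def
    proof (intro tendsto_add_zero tendsto_norm_zero tendsto_mult_left_zero e0)
      show "((\<lambda>j. psi la ra (y a j) (t i) - ula la (tpi (t i)) (y a j)) \<longlongrightarrow> 0) F"
        by (rule psi_minus_tpi_tendsto_0[OF t(1)[OF that] F eventually_mono[OF in\<Lambda> N] y_central])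
    qed
    \<comment> \<open>Apply \<open>psi\<close> at \<open>t i\<close> to
      \<open>D a = c a j + y a j + e a j\<close>. The part from \<open>c\<close> is at most
      \<open>M * \<delta> a i\<close>, and replacing \<open>tpi (t i)\<close> by 1 on
      \<open>y a j\<close> costs at most \<open>p i * N\<close>, both uniformly in \<open>j\<close>;
      the rest is in \<open>R i j\<close>.\<close>
    have diff: "norm (y a i - y a j) \<le> (M * \<delta> a i + p i * N) + R i j"
      if i: "i \<in> \<Lambda>" and j: "j \<in> \<Lambda>" for i j
    proof -
      have "0 \<le> \<delta> a i"
        unfolding \<delta>_def by (intro tdist_nonneg valid_trep_umult t i)
      then have 1: "norm (psi la ra (c a j) (t i)) \<le> M * \<delta> a i"
        unfolding c_def \<delta>_def
        by (intro order_trans[OF norm_psi_commutator_le mult_right_mono] t i M j)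
      have 2: "norm (ula la (tpi (t i)) (y a j) - y a j) \<le> p i * N"
        unfolding p_def
        by (rule order_trans[OF norm_ula_tpi_minus_le mult_left_mono[OF N[OF j] unorm_nonneg]])
      have 3: "norm (psi la ra (e a j) (t i)) \<le> norm (e a j) * rep_norm (t i)"
        by (rule norm_psi_le[OF t(1)[OF i]])
      have "psi la ra (e a j) (t i) = y a i - psi la ra (c a j) (t i) - psi la ra (y a j) (t i)"
        by (simp add: e_def psi_diff[OF t(1)[OF i]] y_def)
      then have eq: "y a i - y a j = psi la ra (c a j) (t i)
          + (psi la ra (y a j) (t i) - ula la (tpi (t i)) (y a j))
          + psi la ra (e a j) (t i) + (ula la (tpi (t i)) (y a j) - y a j)"
        by simp
      have "norm (y a i - y a j) \<le> norm (psi la ra (c a j) (t i))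
          + norm (psi la ra (y a j) (t i) - ula la (tpi (t i)) (y a j))
          + norm (psi la ra (e a j) (t i)) + norm (ula la (tpi (t i)) (y a j) - y a j)"
        unfolding eq by (intro norm_triangle_mono order_refl)
      then show ?thesis
        using 1 2 3 by (simp add: R_def)
    qed
    have "eventually (\<lambda>i. eventually (\<lambda>j. norm (y a i - y a j) < \<epsilon>) F) F" if "\<epsilon> > 0" for \<epsilon>
    proof -
      have "((\<lambda>i. M * \<delta> a i + p i * N) \<longlongrightarrow> 0) F"
        by (intro tendsto_add_zero tendsto_mult_right_zero tendsto_mult_left_zero \<delta>0 p0)
      then have "eventually (\<lambda>i. M * \<delta> a i + p i * N < \<epsilon> / 2) F"
        by (rule order_tendstoD(2)) (use that in simp)
      with in\<Lambda> show ?thesis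
      proof eventually_elim
        fix i assume i: "i \<in> \<Lambda>" and small: "M * \<delta> a i + p i * N < \<epsilon> / 2"
        have "eventually (\<lambda>j. R i j < \<epsilon> / 2) F"
          using that by (intro order_tendstoD(2)[OF R0[OF i]]) simp
        with in\<Lambda> show "eventually (\<lambda>j. norm (y a i - y a j) < \<epsilon>) F"
          by eventually_elim (use diff[OF i] small in fastforce)
      qed
    qed
    then show ?thesis
      using convergent_filter_if_iterated_Cauchy[OF F] by blast
  qed
  then obtain \<tau> where \<tau>: "(y a \<longlongrightarrow> \<tau> a) F" for a
    by metis
  define d where "d a = D a - \<tau> a" for a
  have D_eq: "D a = d a + \<tau> a" for a
    by (simp add: d_def)
  \<comment> \<open>Since \<open>c a i = D a - y a i - e a i\<close>, the inner derivations
    \<open>c\<close> converge pointwise to \<open>d\<close>; linearity, the derivation rule and the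
    bound \<open>2 * M\<close> pass to the limit.\<close>
  have d: "(c a \<longlongrightarrow> d a) F" for a
    using tendsto_diff[OF tendsto_diff[OF tendsto_const \<tau>] e0, of "D a" a a]
    by (simp add: e_def d_def)
  note unique = tendsto_unique[OF F]
  note tendsto_la = bounded_linear.tendsto[OF bounded_bilinear.bounded_linear_right[OF bounded_bilinear_la]]
  note tendsto_ra = bounded_linear.tendsto[OF bounded_bilinear.bounded_linear_left[OF bounded_bilinear_ra]]
  have d_lin: "clinear d"
    unfolding clinear_def
  proof (intro conjI allI)
    fix a b
    have "(c (a + b) \<longlongrightarrow> d a + d b) F"
      using tendsto_add[OF d d, of a b] by (simp add: c_def[abs_def] bimod_simps algebra_simps)
    then show "d (a + b) = d a + d b"
      by (rule unique[OF d])
  next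
    fix k a
    have "(c (scaleC k a) \<longlongrightarrow> scaleC k (d a)) F"
      using bounded_linear.tendsto[OF bounded_linear_scaleC d, of k a]
      by (simp add: c_def[abs_def] bimod_simps scaleC_diff_right)
    then show "d (scaleC k a) = scaleC k (d a)"
      by (rule unique[OF d])
  qed
  have d_der: "d (a * b) = ra (d a) b + la a (d b)" for a b
  proof -
    have "(c (a * b) \<longlongrightarrow> ra (d a) b + la a (d b)) F"
      using tendsto_add[OF tendsto_ra[OF d, of a b] tendsto_la[OF d, of a b]]
      by (simp add: c_def[abs_def] ra_diff_left la_diff_right bimod_simps)
    then show ?thesis
      by (rule unique[OF d])
  qed
  have d_bdd: "norm (d a) \<le> norm a * (2 * M)" for a
  proof (rule tendsto_upperbound[OF tendsto_norm[OF d] _ F])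
    show "eventually (\<lambda>i. norm (c a i) \<le> norm a * (2 * M)) F"
      using in\<Lambda>
    proof eventually_elim
      fix i assume "i \<in> \<Lambda>"
      then have "norm a * norm (x i) \<le> norm a * M"
        by (intro mult_left_mono M) auto
      then show "norm (c a i) \<le> norm a * (2 * M)"
        using norm_triangle_le_diff[OF add_mono[OF norm_la[of a "x i"] norm_ra[of "x i" a]]]
        by (simp add: c_def algebra_simps)
    qed
  qed
  have \<tau>_eq: "\<tau> a = D a - d a" for a
    by (simp add: d_def)
  have \<tau>_lin: "clinear \<tau>"
    using D_lin d_lin by (simp add: clinear_def \<tau>_eq scaleC_diff_right)
  have "norm (\<tau> a) \<le> norm a * (K + 2 * M)" for a
    unfolding \<tau>_eq distrib_left by (intro norm_triangle_le_diff add_mono K d_bdd)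
  then have \<tau>_bdd: "bounded_map \<tau>"
    by (auto simp: bounded_map_def)
  have central: "la b (\<tau> a) = ra (\<tau> a) b" for a b
    using unique[OF tendsto_diff[OF tendsto_la[OF \<tau>] tendsto_ra[OF \<tau>]] y_central, of b a]
    by simp
  have d_comm: "d (a * b - b * a) = d (a * b) - d (b * a)" for a b
    by (rule linear_diff[OF clinear_imp_linear[OF d_lin]])
  have "\<tau> (a * b - b * a) = 0" for a b
  proof -
    \<comment> \<open>Since \<open>\<tau> b\<close> is central, \<open>D b\<close> and
      \<open>d b\<close> have the same commutator with \<open>a\<close>. The Lie identity then gives
      \<open>D\<close> and \<open>d\<close> the same value at \<open>a * b - b * a\<close>.\<close>
    have comm: "la a (D b) - ra (D b) a = la a (d b) - ra (d b) a" for a b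
      using central[of a b] by (simp add: \<tau>_eq la_diff_right ra_diff_left algebra_simps)
    have "D (a * b - b * a) = (la a (D b) - ra (D b) a) - (la b (D a) - ra (D a) b)"
      using D_lie by (simp add: is_lie_derivation_def)
    then show ?thesis
      unfolding comm by (simp add: \<tau>_eq d_comm d_der)
  qed
  moreover have "bounded_map d"
    using d_bdd by (auto simp: bounded_map_def)
  moreover have "is_derivation la ra d"
    by (simp add: is_derivation_def d_der)
  moreover have "\<tau> a \<in> centre la ra" for a
    by (simp add: centre_def central)
  ultimately show ?thesis
    using d_lin \<tau>_lin \<tau>_bdd D_eq by blast
qed

end
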